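(* Let $(f_n(\lambda))_{n\ge 1}$ be the sequence of polynomials in $\lambda$ defined by the recurrence relation $f_n(\lambda) = -\lambda f_{n-1}(\lambda) - f_{n-2}(\lambda)$ for all $n \ge 3$, with initial conditions $f_1(\lambda) = -\lambda$ and $f_2(\lambda) = \lambda^2 - 1$. Then a closed form for this recurrence relation is given, for every integer $m \ge 1$, by $$f_m(\lambda) = \sum_{i=0}^{\lfloor m/2 \rfloor} (-1)^{m+i} \binom{m-i}{i} \lambda^{m-2i}.$$
   Context: $\binom{a}{b}$ denotes the usual binomial coefficient and $\lfloor \cdot \rfloor$ the floor function. *)

theory Defs
  imports "HOL-Computational_Algebra.Polynomial"
begin

text \<open>The indeterminate of the polynomial ring (written as lambda in the mathematical text).\<close>

abbreviation indet :: "'a::comm_ring_1 poly" where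
  "indet \<equiv> [:0, 1:]"

end

theory Submission
  imports Defs
begin

text \<open>Summing up to \<open>m\<close> instead of \<open>m div 2\<close> adds only vanishing binomial coefficients; it
  avoids splitting on the parity of \<open>m\<close> when Pascal's rule is applied termwise.\<close>

definition closed_form :: "'a::comm_ring_1 \<Rightarrow> nat \<Rightarrow> 'a" where
  "closed_form x m = (\<Sum>i\<le>m. (- 1) ^ (m + i) * of_nat ((m - i) choose i) * x ^ (m - 2 * i))"

lemma closed_form_eq_sum_half:
  "closed_form x m = (\<Sum>i = 0..m div 2. (- 1) ^ (m + i) * of_nat ((m - i) choose i) * x ^ (m - 2 * i))"
  unfolding closed_form_def
  by (rule sum.mono_neutral_right) (auto simp: binomial_eq_0)

text \<open>Pascal's rule splits term \<open>j + 1\<close> for \<open>m + 2\<close> into minus term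
  \<open>j\<close> for \<open>m\<close> and minus \<open>x\<close> times term \<open>j + 1\<close>
  for \<open>m + 1\<close>; the index-0 terms for \<open>m + 2\<close> and \<open>m + 1\<close>
  match separately.\<close>

lemma closed_form_rec:
  "closed_form x (Suc (Suc m)) = - x * closed_form x (Suc m) - closed_form x m"
proof -
  let ?a = "\<lambda>j. (- 1) ^ (m + j) * of_nat ((m - j) choose j) * x ^ (m - 2 * j)"
  let ?b = "\<lambda>j. (- 1) ^ (m + j) * of_nat ((m - j) choose Suc j) * x ^ (m - 2 * j)"
  have pascal: "(- 1) ^ (Suc (Suc m) + Suc j) * of_nat ((Suc (Suc m) - Suc j) choose Suc j)
      * x ^ (Suc (Suc m) - 2 * Suc j) = - ?a j - ?b j" if "j \<le> m" for j
    using that by (simp add: Suc_diff_le algebra_simps)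
  have shift: "x * ((- 1) ^ (Suc m + Suc j) * of_nat ((Suc m - Suc j) choose Suc j)
      * x ^ (Suc m - 2 * Suc j)) = ?b j" for j
  proof (cases "Suc (2 * j) \<le> m")
    case True
    then have "m - 2 * j = Suc (Suc m - 2 * Suc j)" by simp
    then show ?thesis by (simp add: mult_ac)
  next
    \<comment> \<open>Here \<open>m \<le> 2 * j\<close>: truncated subtraction makes both exponents
      0, so the extra factor \<open>x\<close> is not absorbed, but the binomial vanishes since
      \<open>m - j < Suc j\<close>.\<close>
    case False
    then show ?thesis by (simp add: binomial_eq_0)
  qed
  \<comment> \<open>Index 0 is split off, and the top index \<open>m + 2\<close> contributes
    \<open>0 choose (m + 2)\<close>, which is 0.\<close>
  have "closed_form x (Suc (Suc m)) = (- 1) ^ m * x ^ Suc (Suc m) + (\<Sum>j\<le>m. - ?a j - ?b j)"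
    unfolding closed_form_def sum.atMost_Suc_shift[of _ "Suc m"] sum.atMost_Suc[of _ m]
    using pascal by (simp add: binomial_eq_0)
  moreover have "x * closed_form x (Suc m) = - ((- 1) ^ m * x ^ Suc (Suc m)) + (\<Sum>j\<le>m. ?b j)"
    unfolding closed_form_def sum.atMost_Suc_shift[of _ m] distrib_left sum_distrib_left shift
    by (simp add: mult_ac)
  ultimately show ?thesis
    by (simp add: closed_form_def[of x m] sum_subtractf sum_negf)
qed

theorem theorem3p2:
  fixes f :: "nat \<Rightarrow> 'a::comm_ring_1 poly" and m :: nat
  assumes "f 1 = - indet"
    and "f 2 = indet ^ 2 - 1"
    and "\<And>n. n \<ge> 3 \<Longrightarrow> f n = - indet * f (n - 1) - f (n - 2)"
    and "m \<ge> 1"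
  shows "f m = (\<Sum>i = 0..m div 2. (- 1) ^ (m + i) * of_nat ((m - i) choose i) * indet ^ (m - 2 * i))"
proof -
  \<comment> \<open>The index is shifted because nothing is assumed about \<open>f 0\<close>; the
    induction step then uses the recurrence at \<open>k + 3\<close>, within its range.\<close>
  have "f (Suc k) = closed_form indet (Suc k)" for k
  proof (induction k rule: induct_nat_012)
    case 0
    show ?case using assms(1) by (simp add: closed_form_def)
  next
    case 1
    show ?case using assms(2)
      by (simp add: closed_form_def numeral_2_eq_2)
  next
    case (ge2 k)
    then show ?case
      using assms(3)[of "Suc (Suc (Suc k))"] closed_form_rec[of "indet :: 'a poly" "Suc k"] by simp
  qed
  from this[of "m - 1"] show ?thesis
    using \<open>m \<ge> 1\<close> by (simp add: closed_form_eq_sum_half)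
qed

end
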